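(* Consider any instance of the congestion game in which every resource uses the Proportional Sharing policy, and let $x$ be any (mixed) Nash equilibrium of it. Then there exists a feasible solution of (SDP-SR) with objective value at least $\frac{2}{3+\sqrt5}\,C(x)$, where $C$ is the social cost under Proportional Sharing. This implies that the coordination ratio is at most $\frac{3+\sqrt5}{2}$, i.e. $C(x)\le\frac{3+\sqrt5}{2}\,C^{SR}(x^* )$ for every Nash equilibrium $x$ and every pure assignment $x^*$, where $C^{SR}$ is the social cost under Smith's Rule.
   Context: Congestion model. $N$ is a finite set of players and $E$ a finite set of resources. Each player $j\in N$ has a weight $w_j>0$, a nonempty strategy set $\mathcal S_j\subseteq 2^E$, and processing times $p_{ej}\in[0,\infty]$ $(e\in E)$, with $p_{ej}<\infty$ whenever $e$ belongs to some strategy $i\in\mathcal S_j$. The Smith ratio is $\delta_{ej}=p_{ej}/w_j$. For each $e\in E$, $\prec_e$ is a strict total order on $N$ such that $k\prec_e j$ implies $\delta_{ek}\le\delta_{ej}$ (ties broken consistently). An assignment is $x=(x_{ij})_{j\in N,i\in\mathcal S_j}$ with $x_{ij}\ge 0$ and $\sum_{i\in\mathcal S_j}x_{ij}=1$ for all $j$ ($x_{ij}$ is the probability that $j$ independently chooses $i$); it is pure if all $x_{ij}\in\{0,1\}$. Put $z_{ej}=\sum_{i\in\mathcal S_j:\,e\in i}x_{ij}$. Terms containing a factor $z_{ek}=0$ are read as $0$. Proportional Sharing. The cost of player $j$ is $$C_j(x)=\sum_{i\in\mathcal S_j}x_{ij}\sum_{e\in i}\Big(p_{ej}+\sum_{k\prec_e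 j}p_{ek}z_{ek}+\sum_{k\succ_e j}w_kz_{ek}\delta_{ej}\Big),$$ and the social cost is $C(x)=\sum_{j\in N}w_jC_j(x)$. Nash equilibrium. $x$ is a (mixed) Nash equilibrium if $C_j(x)\le C_j(x_{-j},i)$ for all $j\in N$, $i\in\mathcal S_j$, where $(x_{-j},i)$ is obtained from $x$ by letting $j$ choose $i$ with probability $1$. Smith's Rule social cost: $C^{SR}(x)=\sum_{j\in N}w_j\sum_{i\in\mathcal S_j}x_{ij}\sum_{e\in i}\big(p_{ej}+\sum_{k\prec_e j}p_{ek}z_{ek}\big)$. The coordination ratio is the worst ratio between $C(x)$ for a Nash equilibrium $x$ (under the given policy) and the minimum of $C^{SR}$ over pure assignments. (SDP-SR): the variables are reals $y_j$ $(j\in N)$ and vectors $v_0, v_{ij}\in\mathbb R^d$ $(j\in N,i\in\mathcal S_j)$ for some $d\in\mathbb N$, with the standard inner product. Maximize $\sum_{j\in N}y_j-\frac12\|v_0\|^2$ subject to $y_j\le\sum_{e\in i}w_jp_{ej}-\frac12\|v_{ij}\|^2+\langle v_0,v_{ij}\rangle$ for all $j\in N,i\in\mathcal S_j$; and $\langle v_{ij},v_{i'k}\rangle\le\sum_{e\in i\cap i'}w_jw_k\min\{\delta_{ej},\delta_{ek}\}$ for all $(i,j)\ne(i',k)$ with $j,k\in N$, $i\in\mathcal S_j$, $i'\in\mathcal S_k$. *)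

theory Defs
  imports "HOL-Library.Extended_Real" "Jordan_Normal_Form.Matrix"
begin

text \<open>
  Costs are extended reals because processing times may be infinite. The library's
  convention \<open>0 * \<infinity> = 0\<close> on \<^typ>\<open>ereal\<close> is exactly the convention that
  terms containing a factor \<open>z_ek = 0\<close> are read as \<open>0\<close>.
  \<open>prec G e k j\<close> means that \<open>k\<close> precedes \<open>j\<close> in the order of resource \<open>e\<close>.
\<close>

record ('n, 'e) congestion_instance =
  players :: "'n set"
  resources :: "'e set"
  strategies :: "'n \<Rightarrow> 'e set set"
  weight :: "'n \<Rightarrow> real"
  ptime :: "'e \<Rightarrow> 'n \<Rightarrow> ereal"
  prec :: "'e \<Rightarrow> 'n \<Rightarrow> 'n \<Rightarrow> bool"

definition smith_ratio :: "('n, 'e) congestion_instance \<Rightarrow> 'e \<Rightarrow> 'n \<Rightarrow> ereal" where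
  "smith_ratio G e j = ptime G e j / ereal (weight G j)"

definition congestion_game :: "('n, 'e) congestion_instance \<Rightarrow> bool" where
  "congestion_game G \<longleftrightarrow>
     finite (players G) \<and> finite (resources G) \<and>
     (\<forall>j\<in>players G.
        0 < weight G j \<and>
        strategies G j \<noteq> {} \<and> strategies G j \<subseteq> Pow (resources G) \<and>
        (\<forall>e\<in>resources G. 0 \<le> ptime G e j) \<and>
        (\<forall>i\<in>strategies G j. \<forall>e\<in>i. ptime G e j < \<infinity>)) \<and>
     (\<forall>e\<in>resources G.
        irreflp_on (players G) (prec G e) \<and>
        transp_on (players G) (prec G e) \<and>
        totalp_on (players G) (prec G e) \<and>
        (\<forall>k\<in>players G. \<forall>j\<in>players G.
           prec G e k j \<longrightarrow> smith_ratio G e k \<le> smith_ratio G e j))"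

text \<open>
  \<open>x j i\<close> is the probability that player \<open>j\<close> chooses strategy \<open>i\<close>; values of \<open>x\<close> outside
  \<open>j \<in> players G\<close>, \<open>i \<in> strategies G j\<close> are never used.
\<close>

definition assignment :: "('n, 'e) congestion_instance \<Rightarrow> ('n \<Rightarrow> 'e set \<Rightarrow> real) \<Rightarrow> bool" where
  "assignment G x \<longleftrightarrow>
     (\<forall>j\<in>players G. (\<forall>i\<in>strategies G j. 0 \<le> x j i) \<and> (\<Sum>i\<in>strategies G j. x j i) = 1)"

definition pure_assignment ::
    "('n, 'e) congestion_instance \<Rightarrow> ('n \<Rightarrow> 'e set \<Rightarrow> real) \<Rightarrow> bool" where
  "pure_assignment G x \<longleftrightarrow>
     assignment G x \<and> (\<forall>j\<in>players G. \<forall>i\<in>strategies G j. x j i \<in> {0, 1})"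

text \<open>The probability \<open>z_ej\<close> that player \<open>j\<close> uses resource \<open>e\<close>.\<close>

definition usage ::
    "('n, 'e) congestion_instance \<Rightarrow> ('n \<Rightarrow> 'e set \<Rightarrow> real) \<Rightarrow> 'e \<Rightarrow> 'n \<Rightarrow> real" where
  "usage G x e j = (\<Sum>i | i \<in> strategies G j \<and> e \<in> i. x j i)"

definition PS_cost ::
    "('n, 'e) congestion_instance \<Rightarrow> ('n \<Rightarrow> 'e set \<Rightarrow> real) \<Rightarrow> 'n \<Rightarrow> ereal" where
  "PS_cost G x j =
     (\<Sum>i\<in>strategies G j. ereal (x j i) *
        (\<Sum>e\<in>i. ptime G e j
           + (\<Sum>k | k \<in> players G \<and> prec G e k j. ptime G e k * ereal (usage G x e k))
           + (\<Sum>k | k \<in> players G \<and> prec G e j k.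
                ereal (weight G k) * ereal (usage G x e k) * smith_ratio G e j)))"

definition PS_social_cost ::
    "('n, 'e) congestion_instance \<Rightarrow> ('n \<Rightarrow> 'e set \<Rightarrow> real) \<Rightarrow> ereal" where
  "PS_social_cost G x = (\<Sum>j\<in>players G. ereal (weight G j) * PS_cost G x j)"

definition deviate :: "('n \<Rightarrow> 'e set \<Rightarrow> real) \<Rightarrow> 'n \<Rightarrow> 'e set \<Rightarrow> 'n \<Rightarrow> 'e set \<Rightarrow> real" where
  "deviate x j i = x(j := (\<lambda>i'. if i' = i then 1 else 0))"

definition PS_nash :: "('n, 'e) congestion_instance \<Rightarrow> ('n \<Rightarrow> 'e set \<Rightarrow> real) \<Rightarrow> bool" where
  "PS_nash G x \<longleftrightarrow>
     assignment G x \<and>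
     (\<forall>j\<in>players G. \<forall>i\<in>strategies G j. PS_cost G x j \<le> PS_cost G (deviate x j i) j)"

definition SR_social_cost ::
    "('n, 'e) congestion_instance \<Rightarrow> ('n \<Rightarrow> 'e set \<Rightarrow> real) \<Rightarrow> ereal" where
  "SR_social_cost G x =
     (\<Sum>j\<in>players G. ereal (weight G j) *
        (\<Sum>i\<in>strategies G j. ereal (x j i) *
           (\<Sum>e\<in>i. ptime G e j
              + (\<Sum>k | k \<in> players G \<and> prec G e k j. ptime G e k * ereal (usage G x e k)))))"

text \<open>
  The infimum is a minimum: there are only finitely many pure assignments up to unused
  values. Division is that of \<^typ>\<open>ereal\<close>, so a positive cost divided by \<open>0\<close> is \<open>\<infinity>\<close> and
  \<open>0 / 0 = 0\<close>.
\<close>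

definition PS_coordination_ratio :: "('n, 'e) congestion_instance \<Rightarrow> ereal" where
  "PS_coordination_ratio G =
     (SUP x\<in>{x. PS_nash G x}.
        PS_social_cost G x / (INF x'\<in>{x'. pure_assignment G x'}. SR_social_cost G x'))"

text \<open>The vector \<open>v_ij\<close> is written \<open>v j i\<close>; squared norms are scalar products \<open>u \<bullet> u\<close>.\<close>

definition SDP_SR_feasible ::
    "('n, 'e) congestion_instance \<Rightarrow> nat \<Rightarrow> ('n \<Rightarrow> real) \<Rightarrow> real vec \<Rightarrow>
      ('n \<Rightarrow> 'e set \<Rightarrow> real vec) \<Rightarrow> bool" where
  "SDP_SR_feasible G d y v0 v \<longleftrightarrow>
     v0 \<in> carrier_vec d \<and>
     (\<forall>j\<in>players G. \<forall>i\<in>strategies G j. v j i \<in> carrier_vec d) \<and>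
     (\<forall>j\<in>players G. \<forall>i\<in>strategies G j.
        ereal (y j) \<le> (\<Sum>e\<in>i. ereal (weight G j) * ptime G e j)
                       + ereal (- (1/2) * (v j i \<bullet> v j i) + v0 \<bullet> v j i)) \<and>
     (\<forall>j\<in>players G. \<forall>i\<in>strategies G j. \<forall>k\<in>players G. \<forall>i'\<in>strategies G k.
        (i, j) \<noteq> (i', k) \<longrightarrow>
        ereal (v j i \<bullet> v k i') \<le>
          (\<Sum>e\<in>i \<inter> i'. ereal (weight G j) * ereal (weight G k)
                          * min (smith_ratio G e j) (smith_ratio G e k)))"

definition SDP_SR_objective ::
    "('n, 'e) congestion_instance \<Rightarrow> ('n \<Rightarrow> real) \<Rightarrow> real vec \<Rightarrow> real" where
  "SDP_SR_objective G y v0 = (\<Sum>j\<in>players G. y j) - (1/2) * (v0 \<bullet> v0)"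

end

theory Submission
  imports Defs
begin

text \<open>
  Choose vectors \<open>\<chi>\<^sub>e\<^sub>j\<close> with \<open>\<langle>\<chi>\<^sub>e\<^sub>j, \<chi>\<^sub>e\<^sub>k\<rangle> = w\<^sub>j w\<^sub>k min(\<delta>\<^sub>e\<^sub>j, \<delta>\<^sub>e\<^sub>k)\<close>, orthogonal for different
  resources, and let \<open>f = \<Sum>\<^sub>e\<Sum>\<^sub>k z\<^sub>e\<^sub>k \<chi>\<^sub>e\<^sub>k\<close>. Up to the diagonal terms, \<open>w\<^sub>j C\<^sub>j(x\<^sub>-\<^sub>j, i)\<close> is
  \<open>\<Sum>\<^sub>e\<^sub>\<in>\<^sub>i (\<parallel>\<chi>\<^sub>e\<^sub>j\<parallel>\<^sup>2 + \<langle>\<chi>\<^sub>e\<^sub>j, f\<rangle>)\<close>, and \<open>\<parallel>f\<parallel>\<^sup>2 \<le> C(x)\<close>. Hence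
  \<open>v\<^sub>i\<^sub>j = \<beta> \<Sum>\<^sub>e\<^sub>\<in>\<^sub>i \<chi>\<^sub>e\<^sub>j\<close>, \<open>v\<^sub>0 = \<alpha> f\<close>, \<open>y\<^sub>j = \<lambda> w\<^sub>j C\<^sub>j(x)\<close> with \<open>\<lambda> = \<alpha> \<beta> = 1 - \<beta>\<^sup>2/2\<close> is
  feasible by the Nash condition, with objective at least \<open>(\<lambda> - \<alpha>\<^sup>2/2) C(x)\<close>; the best choice
  is \<open>\<beta>\<^sup>2 = 2/\<surd>5\<close>. Conversely, summing the first constraints over the strategies of a pure
  assignment and using \<open>\<langle>v\<^sub>0, V\<rangle> \<le> (\<parallel>v\<^sub>0\<parallel>\<^sup>2 + \<parallel>V\<parallel>\<^sup>2)/2\<close> for the sum \<open>V\<close> of their vectors bounds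
  every feasible objective by the Smith's Rule cost.
\<close>

text \<open>An infinite Smith ratio becomes \<open>0\<close>; it only ever occurs multiplied by \<open>z\<^sub>e\<^sub>k = 0\<close>.\<close>

definition real_ratio :: "('n, 'e) congestion_instance \<Rightarrow> 'e \<Rightarrow> 'n \<Rightarrow> real" where
  "real_ratio G e j = real_of_ereal (smith_ratio G e j)"

text \<open>On one resource this is the bound in the second SDP constraint. For \<open>k = j\<close>
  it becomes the squared weight times the Smith ratio, that is \<open>w_j p_ej\<close> on a resource
  that \<open>j\<close> can use.\<close>

definition overlap :: "('n, 'e) congestion_instance \<Rightarrow> 'e \<Rightarrow> 'n \<Rightarrow> 'n \<Rightarrow> real" where
  "overlap G e j k = weight G j * weight G k * min (real_ratio G e j) (real_ratio G e k)"

text \<open>The cost of \<open>j\<close> on \<open>e\<close>, multiplied by \<open>w_j\<close>, if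
  \<open>j\<close> uses \<open>e\<close> with certainty. Player \<open>j\<close> is left out of the
  sum, so the value depends only on the strategies of the others.\<close>

definition load :: "('n, 'e) congestion_instance \<Rightarrow> ('n \<Rightarrow> 'e set \<Rightarrow> real) \<Rightarrow> 'e \<Rightarrow> 'n \<Rightarrow> real" where
  "load G x e j = overlap G e j j + (\<Sum>k\<in>players G - {j}. usage G x e k * overlap G e j k)"

section \<open>Gram vectors for the minimum kernel\<close>

text \<open>\<open>g t\<close> is the gap between \<open>t\<close> and the next smaller point of
  \<open>A\<close>, or 0 if there is none, so the gaps up to \<open>a\<close> telescope to
  \<open>a\<close>. The induction adds a new maximum \<open>b\<close>, whose gap is
  \<open>b - sum g A\<close>. It is nonnegative because \<open>sum g A\<close> is the old maximum,
  or 0 for empty \<open>A\<close>.\<close>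

lemma increments_of_finite_set:
  fixes A :: "real set"
  assumes "finite A" "\<forall>a\<in>A. 0 \<le> a"
  shows "\<exists>g. (\<forall>t\<in>A. 0 \<le> g t) \<and> (\<forall>a\<in>A. (\<Sum>t\<in>{t\<in>A. t \<le> a}. g t) = a)"
  using assms
proof (induction A rule: finite_linorder_max_induct)
  case empty
  then show ?case by simp
next
  case (insert b A)
  then obtain g where g: "\<forall>t\<in>A. 0 \<le> g t" "\<forall>a\<in>A. (\<Sum>t\<in>{t\<in>A. t \<le> a}. g t) = a"
    by auto
  have le: "sum g A \<le> b"
  proof (cases "A = {}")
    case True
    then show ?thesis using insert.prems by simp
  next
    case False
    then have "{t\<in>A. t \<le> Max A} = A" using insert.hyps(1) by auto
    then have "sum g A = Max A" using g(2) Max_in[OF insert.hyps(1) False] by force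
    then show ?thesis using insert.hyps(1,2) False by (simp add: less_imp_le)
  qed
  have nb: "b \<notin> A" using insert.hyps(2) by auto
  let ?g = "g(b := b - sum g A)"
  have same: "sum ?g B = sum g B" if "B \<subseteq> A" for B
    using that nb by (intro sum.cong) auto
  have "(\<Sum>t\<in>{t\<in>insert b A. t \<le> a}. ?g t) = a" if "a \<in> insert b A" for a
  proof (cases "a = b")
    case True
    then have "{t\<in>insert b A. t \<le> a} = insert b A" using insert.hyps(2) by (auto simp: less_imp_le)
    then show ?thesis using True insert.hyps(1) nb same[of A] by simp
  next
    case False
    then have "a \<in> A" "{t\<in>insert b A. t \<le> a} = {t\<in>A. t \<le> a}" using that insert.hyps(2) by auto
    then show ?thesis using same[of "{t\<in>A. t \<le> a}"] g(2) by simp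
  qed
  then show ?case using g(1) le by (intro exI[of _ ?g]) auto
qed

lemma min_gram:
  fixes A :: "real set"
  assumes "finite A" "\<forall>a\<in>A. 0 \<le> a"
  shows "\<exists>\<phi>. \<forall>a\<in>A. \<forall>b\<in>A. (\<Sum>t\<in>A. \<phi> a t * \<phi> b t) = min a b"
proof -
  obtain g where g: "\<forall>t\<in>A. 0 \<le> g t" "\<forall>a\<in>A. (\<Sum>t\<in>{t\<in>A. t \<le> a}. g t) = a"
    using increments_of_finite_set[OF assms] by auto
  \<comment> \<open>Indicators of \<open>[0, a]\<close>, discretized at the points of \<open>A\<close>.\<close>
  define \<phi> where "\<phi> a t = (if t \<le> a then sqrt (g t) else 0)" for a t
  have "(\<Sum>t\<in>A. \<phi> a t * \<phi> b t) = min a b" if "a \<in> A" "b \<in> A" for a b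
  proof -
    have "(\<Sum>t\<in>A. \<phi> a t * \<phi> b t) = (\<Sum>t\<in>A. if t \<le> min a b then g t else 0)"
      using g(1) by (intro sum.cong) (auto simp: \<phi>_def)
    also have "\<dots> = (\<Sum>t\<in>{t\<in>A. t \<le> min a b}. g t)"
      using assms(1) by (simp add: sum.inter_filter)
    also have "\<dots> = min a b" using g(2) that by (auto simp: min_def)
    finally show ?thesis .
  qed
  then show ?thesis by blast
qed

text \<open>Each resource gets its own block of coordinates, indexed by the values of
  \<open>d\<close>, which makes vectors of different resources orthogonal. Inside a block the
  vectors of \<open>min_gram\<close> are scaled by the weights. The bijection \<open>h\<close>
  numbers the coordinates by naturals, as \<open>vec\<close> requires.\<close>

lemma gram_realization:
  fixes d :: "'e \<Rightarrow> 'n \<Rightarrow> real" and w :: "'n \<Rightarrow> real"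
  assumes "finite E" "finite N" "\<And>e j. 0 \<le> d e j"
  shows "\<exists>(D::nat) \<chi>. \<forall>e\<in>E. \<forall>e'\<in>E. \<forall>j\<in>N. \<forall>k\<in>N.
    (\<Sum>n = 0..<D. \<chi> e j n * \<chi> e' k n) =
      (if e = e' then w j * w k * min (d e j) (d e k) else 0)"
proof -
  define A where "A = (\<lambda>(e, j). d e j) ` (E \<times> N)"
  have A: "finite A" "\<forall>a\<in>A. 0 \<le> a" using assms by (auto simp: A_def)
  obtain \<phi> where \<phi>: "\<forall>a\<in>A. \<forall>b\<in>A. (\<Sum>t\<in>A. \<phi> a t * \<phi> b t) = min a b"
    using min_gram[OF A] by blast
  obtain h where h: "bij_betw h {0..<card (E \<times> A)} (E \<times> A)"
    using ex_bij_betw_nat_finite[of "E \<times> A"] assms(1) A(1) by auto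
  define X where "X e j = (\<lambda>(e', t). if e' = e then w j * \<phi> (d e j) t else 0)" for e j
  have "(\<Sum>n = 0..<card (E \<times> A). X e j (h n) * X e' k (h n)) =
      (if e = e' then w j * w k * min (d e j) (d e k) else 0)"
    if "e \<in> E" "e' \<in> E" "j \<in> N" "k \<in> N" for e e' j k
  proof -
    have dA: "d e j \<in> A" "d e k \<in> A" using that unfolding A_def by force+
    have "(\<Sum>n = 0..<card (E \<times> A). X e j (h n) * X e' k (h n)) = (\<Sum>p\<in>E \<times> A. X e j p * X e' k p)"
      using sum.reindex_bij_betw[OF h, of "\<lambda>p. X e j p * X e' k p"] by simp
    also have "\<dots> = (\<Sum>f\<in>E. \<Sum>t\<in>A. X e j (f, t) * X e' k (f, t))"
      by (simp add: sum.cartesian_product)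
    also have "\<dots> = (\<Sum>f\<in>E. if f = e then
        (if e = e' then w j * w k * (\<Sum>t\<in>A. \<phi> (d e j) t * \<phi> (d e k) t) else 0) else 0)"
      by (intro sum.cong) (auto simp: X_def sum_distrib_left mult_ac)
    also have "\<dots> = (if e = e' then w j * w k * min (d e j) (d e k) else 0)"
      using assms(1) that(1) bspec[OF bspec[OF \<phi> dA(1)] dA(2)] by (cases "e = e'") simp_all
    finally show ?thesis .
  qed
  then show ?thesis by (intro exI[of _ "card (E \<times> A)"] exI[of _ "\<lambda>e j n. X e j (h n)"]) blast
qed

lemma inner_sum_sum:
  fixes f :: "'a \<Rightarrow> nat \<Rightarrow> real" and g :: "'b \<Rightarrow> nat \<Rightarrow> real"
  shows "(\<Sum>n = 0..<D. (\<Sum>a\<in>A. f a n) * (\<Sum>b\<in>B. g b n)) =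
    (\<Sum>a\<in>A. \<Sum>b\<in>B. \<Sum>n = 0..<D. f a n * g b n)"
proof -
  have "(\<Sum>n = 0..<D. (\<Sum>a\<in>A. f a n) * (\<Sum>b\<in>B. g b n)) =
      (\<Sum>n = 0..<D. \<Sum>a\<in>A. \<Sum>b\<in>B. f a n * g b n)"
    by (simp add: sum_product)
  also have "\<dots> = (\<Sum>a\<in>A. \<Sum>n = 0..<D. \<Sum>b\<in>B. f a n * g b n)" by (rule sum.swap)
  also have "\<dots> = (\<Sum>a\<in>A. \<Sum>b\<in>B. \<Sum>n = 0..<D. f a n * g b n)"
    by (intro sum.cong refl sum.swap)
  finally show ?thesis .
qed

section \<open>Costs as finite real expressions in loads and overlaps\<close>

locale congestion =
  fixes G :: "('n, 'e) congestion_instance"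
  assumes game: "congestion_game G"
begin

lemma finite_players: "finite (players G)"
  and finite_resources: "finite (resources G)"
  using game by (auto simp: congestion_game_def)

lemma weight_pos: "j \<in> players G \<Longrightarrow> 0 < weight G j"
  using game by (auto simp: congestion_game_def)

lemma strategy_subset: "j \<in> players G \<Longrightarrow> i \<in> strategies G j \<Longrightarrow> i \<subseteq> resources G"
  using game unfolding congestion_game_def by blast

lemma finite_strategies: "j \<in> players G \<Longrightarrow> finite (strategies G j)"
  by (rule finite_subset[of _ "Pow (resources G)"]) (use strategy_subset finite_resources in auto)

lemma finite_strategy: "j \<in> players G \<Longrightarrow> i \<in> strategies G j \<Longrightarrow> finite i"
  using strategy_subset finite_resources finite_subset by blast

lemma ptime_used:
  assumes "j \<in> players G" "i \<in> strategies G j" "e \<in> i"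
  shows "ptime G e j = ereal (weight G j * real_ratio G e j)"
    and "smith_ratio G e j = ereal (real_ratio G e j)"
proof -
  have "0 \<le> ptime G e j" "ptime G e j < \<infinity>"
    using game assms strategy_subset[OF assms(1,2)] by (auto simp: congestion_game_def)
  then obtain p where "ptime G e j = ereal p" by (cases "ptime G e j") auto
  then show "ptime G e j = ereal (weight G j * real_ratio G e j)"
    and "smith_ratio G e j = ereal (real_ratio G e j)"
    using weight_pos[OF assms(1)] by (auto simp: real_ratio_def smith_ratio_def)
qed

lemma real_ratio_nonneg:
  assumes "e \<in> resources G" "j \<in> players G"
  shows "0 \<le> real_ratio G e j"
  using game assms weight_pos[OF assms(2)] unfolding real_ratio_def smith_ratio_def congestion_game_def
  by (auto intro!: real_of_ereal_pos zero_le_divide_ereal)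

text \<open>A strategy of \<open>k\<close> through \<open>e\<close> makes \<open>p_ek\<close>
  finite. Hence an infinite processing time can only meet the factor 0.\<close>

lemma usage_nonzeroE:
  assumes "usage G x e k \<noteq> 0"
  obtains i where "i \<in> strategies G k" "e \<in> i"
proof -
  have "{i. i \<in> strategies G k \<and> e \<in> i} \<noteq> {}"
    using assms unfolding usage_def by (metis sum.empty)
  then show ?thesis using that by blast
qed

lemma overlap_commute: "overlap G e j k = overlap G e k j"
  by (simp add: overlap_def min.commute)

lemma overlap_nonneg:
  "e \<in> resources G \<Longrightarrow> j \<in> players G \<Longrightarrow> k \<in> players G \<Longrightarrow> 0 \<le> overlap G e j k"
  using real_ratio_nonneg weight_pos by (simp add: overlap_def less_imp_le)

text \<open>Both players must have a strategy through \<open>e\<close>: an infinite ratio becomes 0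
  in \<open>real_ratio\<close>, which would destroy monotonicity.\<close>

lemma real_ratio_mono:
  assumes "k \<in> players G" "i \<in> strategies G k" "e \<in> i"
    and "j \<in> players G" "i' \<in> strategies G j" "e \<in> i'" "prec G e k j"
  shows "real_ratio G e k \<le> real_ratio G e j"
proof -
  have "smith_ratio G e k \<le> smith_ratio G e j"
    using game assms strategy_subset[of j i'] unfolding congestion_game_def by blast
  then show ?thesis using ptime_used(2) assms by (metis ereal_less_eq(3))
qed

text \<open>As \<open>k\<close> comes first, the minimum in \<open>overlap\<close> is the ratio of
  \<open>k\<close>, and its product with \<open>w_k\<close> is \<open>p_ek\<close>. If the usage is
  0, both sides vanish, even for infinite \<open>p_ek\<close>. In \<open>later_term\<close> the
  minimum is the ratio of \<open>j\<close>, and the same expression results.\<close>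

lemma earlier_term:
  assumes "j \<in> players G" "i \<in> strategies G j" "e \<in> i" "k \<in> players G" "prec G e k j"
  shows "ptime G e k * ereal (usage G x e k) = ereal (usage G x e k * overlap G e j k / weight G j)"
proof (cases "usage G x e k = 0")
  case True
  then show ?thesis by (simp add: zero_ereal_def[symmetric])
next
  case False
  then obtain i' where i': "i' \<in> strategies G k" "e \<in> i'" by (rule usage_nonzeroE)
  then show ?thesis
    using real_ratio_mono[OF assms(4) i' assms(1-3,5)] ptime_used[OF assms(4) i'] weight_pos[OF assms(1)]
    by (simp add: overlap_def)
qed

lemma later_term:
  assumes "j \<in> players G" "i \<in> strategies G j" "e \<in> i" "k \<in> players G" "prec G e j k"
  shows "ereal (weight G k) * ereal (usage G x e k) * smith_ratio G e j =
    ereal (usage G x e k * overlap G e j k / weight G j)"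
proof (cases "usage G x e k = 0")
  case True
  then show ?thesis by (simp add: zero_ereal_def[symmetric])
next
  case False
  then obtain i' where i': "i' \<in> strategies G k" "e \<in> i'" by (rule usage_nonzeroE)
  then show ?thesis
    using real_ratio_mono[OF assms(1-4) i' assms(5)] ptime_used[OF assms(1-3)] weight_pos[OF assms(1)]
    by (simp add: overlap_def)
qed

lemma own_term:
  assumes "j \<in> players G" "i \<in> strategies G j" "e \<in> i"
  shows "ptime G e j = ereal (overlap G e j j / weight G j)"
  using ptime_used(1)[OF assms] weight_pos[OF assms(1)] by (simp add: overlap_def)

lemma pair_term:
  assumes "j \<in> players G" "i \<in> strategies G j" "k \<in> players G" "i' \<in> strategies G k"
  shows "(\<Sum>e\<in>i \<inter> i'. ereal (weight G j) * ereal (weight G k)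
    * min (smith_ratio G e j) (smith_ratio G e k)) = ereal (\<Sum>e\<in>i \<inter> i'. overlap G e j k)"
proof -
  have "ereal (weight G j) * ereal (weight G k) * min (smith_ratio G e j) (smith_ratio G e k) =
      ereal (overlap G e j k)" if "e \<in> i \<inter> i'" for e
    using ptime_used(2)[of j i e] ptime_used(2)[of k i' e] assms that by (simp add: overlap_def min_def)
  then show ?thesis by (subst sum_ereal[symmetric]) (intro sum.cong refl, auto)
qed

lemma prec_split:
  assumes "e \<in> resources G" "j \<in> players G"
  shows "players G - {j} = {k. k \<in> players G \<and> prec G e k j} \<union> {k. k \<in> players G \<and> prec G e j k}"
    and "{k. k \<in> players G \<and> prec G e k j} \<inter> {k. k \<in> players G \<and> prec G e j k} = {}"
proof -
  have ord: "irreflp_on (players G) (prec G e)" "transp_on (players G) (prec G e)"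
    "totalp_on (players G) (prec G e)"
    using game assms unfolding congestion_game_def by blast+
  show "players G - {j} = {k. k \<in> players G \<and> prec G e k j} \<union> {k. k \<in> players G \<and> prec G e j k}"
    using ord assms(2) unfolding irreflp_on_def totalp_on_def by blast
  show "{k. k \<in> players G \<and> prec G e k j} \<inter> {k. k \<in> players G \<and> prec G e j k} = {}"
    using ord assms(2) unfolding irreflp_on_def transp_on_def by blast
qed

text \<open>Earlier and later players contribute terms of the same form, and together they are all
  players except \<open>j\<close>. Thus the order of the resource disappears from the cost.\<close>

lemma weighted_PS_cost:
  assumes j: "j \<in> players G"
  shows "ereal (weight G j) * PS_cost G x j =
    ereal (\<Sum>i\<in>strategies G j. x j i * (\<Sum>e\<in>i. load G x e j))"
proof -
  have "ptime G e j
      + (\<Sum>k | k \<in> players G \<and> prec G e k j. ptime G e k * ereal (usage G x e k))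
      + (\<Sum>k | k \<in> players G \<and> prec G e j k.
           ereal (weight G k) * ereal (usage G x e k) * smith_ratio G e j)
      = ereal (load G x e j / weight G j)"
    if i: "i \<in> strategies G j" "e \<in> i" for i e
  proof -
    have e: "e \<in> resources G" using strategy_subset j i by blast
    have "(\<Sum>k | k \<in> players G \<and> prec G e k j. ptime G e k * ereal (usage G x e k)) =
        ereal (\<Sum>k | k \<in> players G \<and> prec G e k j. usage G x e k * overlap G e j k / weight G j)"
      using earlier_term[OF j i] by (subst sum_ereal[symmetric]) (auto intro!: sum.cong)
    moreover have "(\<Sum>k | k \<in> players G \<and> prec G e j k.
           ereal (weight G k) * ereal (usage G x e k) * smith_ratio G e j) =
        ereal (\<Sum>k | k \<in> players G \<and> prec G e j k. usage G x e k * overlap G e j k / weight G j)"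
      using later_term[OF j i] by (subst sum_ereal[symmetric]) (auto intro!: sum.cong)
    moreover have "(\<Sum>k\<in>players G - {j}. usage G x e k * overlap G e j k) =
      (\<Sum>k | k \<in> players G \<and> prec G e k j. usage G x e k * overlap G e j k) +
      (\<Sum>k | k \<in> players G \<and> prec G e j k. usage G x e k * overlap G e j k)"
      unfolding prec_split(1)[OF e j]
      using prec_split(2)[OF e j] finite_players by (intro sum.union_disjoint) auto
    ultimately show ?thesis
      by (simp only: own_term[OF j i] load_def plus_ereal.simps sum_divide_distrib[symmetric]
          add_divide_distrib add.assoc)
  qed
  then have "PS_cost G x j =
      (\<Sum>i\<in>strategies G j. ereal (x j i) * (\<Sum>e\<in>i. ereal (load G x e j / weight G j)))"
    unfolding PS_cost_def by (intro sum.cong refl arg_cong2[where f = "(*)"]) auto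
  also have "\<dots> = ereal ((\<Sum>i\<in>strategies G j. x j i * (\<Sum>e\<in>i. load G x e j)) / weight G j)"
    by (simp add: sum_divide_distrib[symmetric])
  finally show ?thesis using weight_pos[OF j] by simp
qed

lemma sum_strategies_usage:
  assumes "j \<in> players G"
  shows "(\<Sum>i\<in>strategies G j. x j i * (\<Sum>e\<in>i. F e)) = (\<Sum>e\<in>resources G. usage G x e j * F e)"
proof -
  have "(\<Sum>i\<in>strategies G j. x j i * (\<Sum>e\<in>i. F e)) =
      (\<Sum>i\<in>strategies G j. \<Sum>e\<in>resources G. if e \<in> i then x j i * F e else 0)"
  proof (intro sum.cong refl)
    fix i assume "i \<in> strategies G j"
    then have "resources G \<inter> i = i" using strategy_subset assms by blast
    then show "x j i * (\<Sum>e\<in>i. F e) = (\<Sum>e\<in>resources G. if e \<in> i then x j i * F e else 0)"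
      using finite_resources by (simp add: sum.inter_restrict[symmetric] sum_distrib_left)
  qed
  also have "\<dots> = (\<Sum>e\<in>resources G. \<Sum>i\<in>strategies G j. if e \<in> i then x j i * F e else 0)"
    by (rule sum.swap)
  also have "\<dots> = (\<Sum>e\<in>resources G. usage G x e j * F e)"
    using finite_strategies[OF assms]
    unfolding usage_def sum_distrib_right by (simp add: sum.inter_filter)
  finally show ?thesis .
qed

lemma PS_social_cost_eq:
  "PS_social_cost G x = ereal (\<Sum>j\<in>players G. \<Sum>e\<in>resources G. usage G x e j * load G x e j)"
  unfolding PS_social_cost_def
  by (subst sum_ereal[symmetric]) (auto intro!: sum.cong simp: weighted_PS_cost sum_strategies_usage)

lemma usage_bounds:
  assumes "assignment G x" "j \<in> players G"
  shows "0 \<le> usage G x e j" "usage G x e j \<le> 1"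
proof -
  have x: "\<forall>i\<in>strategies G j. 0 \<le> x j i" "(\<Sum>i\<in>strategies G j. x j i) = 1"
    using assms by (auto simp: assignment_def)
  then show "0 \<le> usage G x e j" by (auto simp: usage_def intro: sum_nonneg)
  have "usage G x e j \<le> (\<Sum>i\<in>strategies G j. x j i)"
    unfolding usage_def using x finite_strategies[OF assms(2)] by (intro sum_mono2) auto
  then show "usage G x e j \<le> 1" using x by simp
qed

section \<open>Consequences of equilibrium and of mixed usage\<close>

text \<open>The loads that \<open>j\<close> faces do not change when \<open>j\<close> deviates, so
  the weighted cost of the deviation to \<open>i\<close> is exactly the sum of the present loads
  over \<open>i\<close>.\<close>

lemma nash_load:
  assumes "PS_nash G x" "j \<in> players G" "i \<in> strategies G j"
  shows "(\<Sum>e\<in>resources G. usage G x e j * load G x e j) \<le> (\<Sum>e\<in>i. load G x e j)"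
proof -
  have "load G (deviate x j i) e j = load G x e j" for e
    by (auto simp: load_def usage_def deviate_def intro!: sum.cong)
  then have "(\<Sum>i'\<in>strategies G j. deviate x j i j i' * (\<Sum>e\<in>i'. load G (deviate x j i) e j)) =
      (\<Sum>i'\<in>strategies G j. if i' = i then (\<Sum>e\<in>i'. load G x e j) else 0)"
    by (intro sum.cong) (auto simp: deviate_def)
  also have "\<dots> = (\<Sum>e\<in>i. load G x e j)" using assms finite_strategies by simp
  finally have dev: "(\<Sum>i'\<in>strategies G j. deviate x j i j i' * (\<Sum>e\<in>i'. load G (deviate x j i) e j)) =
     (\<Sum>e\<in>i. load G x e j)" .
  have "PS_cost G x j \<le> PS_cost G (deviate x j i) j"
    using assms by (auto simp: PS_nash_def)
  then have "ereal (weight G j) * PS_cost G x j \<le> ereal (weight G j) * PS_cost G (deviate x j i) j"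
    using weight_pos[OF assms(2)] by (intro ereal_mult_left_mono) auto
  then show ?thesis
    unfolding weighted_PS_cost[OF assms(2)] dev sum_strategies_usage[OF assms(2)] by simp
qed

text \<open>The two sides differ only in the diagonal terms, which carry the square of a usage on
  the left and the usage itself on the right. A usage lies in [0, 1].\<close>

lemma square_le_social_cost:
  assumes "assignment G x"
  shows "(\<Sum>e\<in>resources G. \<Sum>j\<in>players G. \<Sum>k\<in>players G. usage G x e j * usage G x e k * overlap G e j k)
    \<le> (\<Sum>j\<in>players G. \<Sum>e\<in>resources G. usage G x e j * load G x e j)"
proof -
  have "(\<Sum>k\<in>players G. usage G x e j * usage G x e k * overlap G e j k) \<le> usage G x e j * load G x e j"
    if "e \<in> resources G" "j \<in> players G" for e j
  proof -
    have "usage G x e j * usage G x e j * overlap G e j j \<le> usage G x e j * overlap G e j j"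
      using usage_bounds[OF assms that(2)] overlap_nonneg[OF that that(2)]
      by (intro mult_right_mono mult_left_le) auto
    then show ?thesis
      unfolding load_def
      using sum.remove[OF finite_players that(2), of "\<lambda>k. usage G x e j * usage G x e k * overlap G e j k"]
      by (simp add: algebra_simps sum_distrib_left)
  qed
  then show ?thesis
    by (subst (2) sum.swap) (intro sum_mono, auto)
qed

section \<open>A feasible SDP solution from an equilibrium\<close>

lemma SDP_solution:
  assumes nash: "PS_nash G x"
  shows "\<exists>d y v0 v. SDP_SR_feasible G d y v0 v \<and>
     ereal (SDP_SR_objective G y v0) \<ge> ereal (2 / (3 + sqrt 5)) * PS_social_cost G x"
proof -
  let ?N = "players G" and ?E = "resources G" and ?S = "strategies G"
  define C where "C = (\<Sum>j\<in>?N. \<Sum>e\<in>?E. usage G x e j * load G x e j)"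
  have asg: "assignment G x" using nash by (simp add: PS_nash_def)
  \<comment> \<open>\<open>gram_realization\<close> asks for nonnegative values everywhere, whereas
    ratios are known to be nonnegative only for resources and players of the game. The cut at 0 is
    undone in \<open>gram'\<close>.\<close>
  obtain D :: nat and \<chi> where gram: "\<forall>e\<in>?E. \<forall>e'\<in>?E. \<forall>j\<in>?N. \<forall>k\<in>?N.
    (\<Sum>n = 0..<D. \<chi> e j n * \<chi> e' k n) = (if e = e' then weight G j * weight G k *
       min (max 0 (real_ratio G e j)) (max 0 (real_ratio G e k)) else 0)"
    using gram_realization[OF finite_resources finite_players, of "\<lambda>e j. max 0 (real_ratio G e j)" "weight G"]
    by auto
  have gram': "(\<Sum>n = 0..<D. \<chi> e j n * \<chi> e' k n) = (if e = e' then overlap G e j k else 0)"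
    if "e \<in> ?E" "e' \<in> ?E" "j \<in> ?N" "k \<in> ?N" for e e' j k
    using gram that real_ratio_nonneg by (auto simp: overlap_def max_def)
  \<comment> \<open>\<open>b\<close> maximizes \<open>(1 - b/2) - (1 - b/2)\<^sup>2 / (2 b)\<close>.\<close>
  define b where "b = 2 / sqrt 5"
  \<comment> \<open>In the first constraint the own terms get the factor \<open>1 - b / 2\<close>
    once half the squared norm is subtracted, and the cross terms get
    \<open>\<alpha> * \<beta>\<close>. Making both equal to \<open>l\<close> turns the right side
    into \<open>l\<close> times a bound from the Nash condition.\<close>
  define l where "l = 1 - b / 2"
  define \<beta> where "\<beta> = sqrt b"
  define \<alpha> where "\<alpha> = l / \<beta>"
  have b: "0 < b" "b \<le> 1" by (auto simp: b_def real_le_rsqrt)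
  have l: "0 \<le> l" using b by (simp add: l_def)
  have \<beta>: "\<beta> * \<beta> = b" "0 < \<beta>" using b by (auto simp: \<beta>_def)
  have \<alpha>: "\<alpha> * \<beta> = l" "\<alpha> * \<alpha> = l\<^sup>2 / b" using \<beta> by (auto simp: \<alpha>_def power2_eq_square)
  have rate: "l - l\<^sup>2 / b / 2 = 2 / (3 + sqrt 5)"
  proof -
    have "l - l\<^sup>2 / b / 2 = (3 - sqrt 5) / 2"
      by (simp add: l_def b_def field_simps power2_eq_square)
    moreover have "(3 - sqrt 5) / 2 = 2 / (3 + sqrt 5)"
      by (simp add: field_simps add_pos_pos less_imp_neq[THEN not_sym] del: real_sqrt_eq_iff)
    ultimately show ?thesis by simp
  qed
  define v where "v j i = vec D (\<lambda>n. \<Sum>e\<in>i. \<beta> * \<chi> e j n)" for j i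
  \<comment> \<open>Resource and player form one index \<open>p\<close>, so that
    \<open>inner_sum_sum\<close> applies with a single outer sum.\<close>
  define v0 where "v0 = vec D (\<lambda>n. \<Sum>p\<in>?E \<times> ?N. \<alpha> * usage G x (fst p) (snd p) * \<chi> (fst p) (snd p) n)"
  define y where "y j = l * (\<Sum>e\<in>?E. usage G x e j * load G x e j)" for j
  have vv: "v j i \<bullet> v k i' = b * (\<Sum>e\<in>i \<inter> i'. overlap G e j k)"
    if "j \<in> ?N" "i \<in> ?S j" "k \<in> ?N" "i' \<in> ?S k" for i j i' k
  proof -
    have sub: "i \<subseteq> ?E" "i' \<subseteq> ?E" "finite i" "finite i'"
      using that strategy_subset finite_strategy by auto
    have "v j i \<bullet> v k i' = (\<Sum>e\<in>i. \<Sum>e'\<in>i'. \<Sum>n = 0..<D. \<beta> * \<chi> e j n * (\<beta> * \<chi> e' k n))"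
      by (simp add: v_def scalar_prod_def inner_sum_sum)
    also have "\<dots> = (\<Sum>e\<in>i. \<Sum>e'\<in>i'. b * (\<Sum>n = 0..<D. \<chi> e j n * \<chi> e' k n))"
      by (simp add: sum_distrib_left \<beta>(1)[symmetric] mult_ac)
    also have "\<dots> = (\<Sum>e\<in>i. \<Sum>e'\<in>i'. if e' = e then b * overlap G e j k else 0)"
      using sub that by (intro sum.cong refl) (auto simp: gram' subset_iff)
    also have "\<dots> = b * (\<Sum>e\<in>i \<inter> i'. overlap G e j k)"
      using sub by (simp add: sum.inter_restrict sum_distrib_left if_distrib cong: if_cong)
    finally show ?thesis .
  qed
  have v0v: "v0 \<bullet> v j i = l * (\<Sum>e\<in>i. \<Sum>k\<in>?N. usage G x e k * overlap G e j k)"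
    if "j \<in> ?N" "i \<in> ?S j" for i j
  proof -
    have sub: "i \<subseteq> ?E" "finite i"
      using that strategy_subset finite_strategy by auto
    have "v0 \<bullet> v j i = (\<Sum>p\<in>?E \<times> ?N. \<Sum>e\<in>i. \<Sum>n = 0..<D.
        \<alpha> * usage G x (fst p) (snd p) * \<chi> (fst p) (snd p) n * (\<beta> * \<chi> e j n))"
      by (simp add: v_def v0_def scalar_prod_def inner_sum_sum)
    also have "\<dots> = (\<Sum>p\<in>?E \<times> ?N. \<Sum>e\<in>i. l * usage G x (fst p) (snd p) *
        (\<Sum>n = 0..<D. \<chi> (fst p) (snd p) n * \<chi> e j n))"
      by (simp add: sum_distrib_left \<alpha>(1)[symmetric] mult_ac)
    also have "\<dots> = (\<Sum>p\<in>?E \<times> ?N. \<Sum>e\<in>i. if e = fst p then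
        l * (usage G x e (snd p) * overlap G e j (snd p)) else 0)"
      using sub that by (intro sum.cong refl) (auto simp: gram' subset_iff overlap_commute)
    also have "\<dots> = (\<Sum>e\<in>i. \<Sum>e'\<in>?E. if e' = e then \<Sum>k\<in>?N.
        l * (usage G x e k * overlap G e j k) else 0)"
    proof (subst sum.swap, intro sum.cong refl)
      fix e assume "e \<in> i"
      have "(\<Sum>p\<in>?E \<times> ?N. if e = fst p then l * (usage G x e (snd p) * overlap G e j (snd p)) else 0)
          = (\<Sum>e'\<in>?E. \<Sum>k\<in>?N. if e = e' then l * (usage G x e k * overlap G e j k) else 0)"
        by (simp add: sum.cartesian_product split_def)
      then show "(\<Sum>p\<in>?E \<times> ?N. if e = fst p then l * (usage G x e (snd p) * overlap G e j (snd p)) else 0)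
          = (\<Sum>e'\<in>?E. if e' = e then \<Sum>k\<in>?N. l * (usage G x e k * overlap G e j k) else 0)"
        by (elim trans) (intro sum.cong refl, auto)
    qed
    also have "\<dots> = l * (\<Sum>e\<in>i. \<Sum>k\<in>?N. usage G x e k * overlap G e j k)"
      using sub finite_resources by (auto simp: sum_distrib_left intro!: sum.cong)
    finally show ?thesis .
  qed
  have v0v0: "v0 \<bullet> v0 = l\<^sup>2 / b * (\<Sum>e\<in>?E. \<Sum>j\<in>?N. \<Sum>k\<in>?N. usage G x e j * usage G x e k * overlap G e j k)"
  proof -
    have "v0 \<bullet> v0 = (\<Sum>p\<in>?E \<times> ?N. \<Sum>q\<in>?E \<times> ?N. \<Sum>n = 0..<D.
        \<alpha> * usage G x (fst p) (snd p) * \<chi> (fst p) (snd p) n *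
        (\<alpha> * usage G x (fst q) (snd q) * \<chi> (fst q) (snd q) n))"
      by (simp add: v0_def scalar_prod_def inner_sum_sum)
    also have "\<dots> = (\<Sum>p\<in>?E \<times> ?N. \<Sum>q\<in>?E \<times> ?N. l\<^sup>2 / b * (usage G x (fst p) (snd p) *
        usage G x (fst q) (snd q) * (\<Sum>n = 0..<D. \<chi> (fst p) (snd p) n * \<chi> (fst q) (snd q) n)))"
      by (simp only: sum_distrib_left \<alpha>(2)[symmetric] mult_ac)
    also have "\<dots> = (\<Sum>p\<in>?E \<times> ?N. \<Sum>q\<in>?E \<times> ?N. if fst q = fst p then
        l\<^sup>2 / b * (usage G x (fst p) (snd p) * usage G x (fst p) (snd q) *
         overlap G (fst p) (snd p) (snd q)) else 0)"
      by (intro sum.cong refl) (auto simp: gram')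
    also have "\<dots> = (\<Sum>e\<in>?E. \<Sum>j\<in>?N. \<Sum>e'\<in>?E. \<Sum>k\<in>?N. if e' = e then
        l\<^sup>2 / b * (usage G x e j * usage G x e k * overlap G e j k) else 0)"
      by (simp add: sum.cartesian_product' cong: if_cong)
    also have "\<dots> = (\<Sum>e\<in>?E. \<Sum>j\<in>?N. \<Sum>e'\<in>?E. if e' = e then \<Sum>k\<in>?N.
        l\<^sup>2 / b * (usage G x e j * usage G x e k * overlap G e j k) else 0)"
      by (intro sum.cong refl) auto
    also have "\<dots> = l\<^sup>2 / b * (\<Sum>e\<in>?E. \<Sum>j\<in>?N. \<Sum>k\<in>?N. usage G x e j * usage G x e k * overlap G e j k)"
      using finite_resources by (auto simp: sum_distrib_left intro!: sum.cong)
    finally show ?thesis .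
  qed
  have "SDP_SR_feasible G D y v0 v"
    unfolding SDP_SR_feasible_def
  proof (intro conjI ballI impI)
    fix j i assume ji: "j \<in> ?N" "i \<in> ?S j"
    have own: "(\<Sum>e\<in>i. ereal (weight G j) * ptime G e j) = ereal (\<Sum>e\<in>i. overlap G e j j)"
      using own_term[OF ji] weight_pos[OF ji(1)] by (subst sum_ereal[symmetric]) (auto intro!: sum.cong)
    \<comment> \<open>\<open>v0\<close> also contains the contribution of \<open>j\<close> itself,
      which \<open>load\<close> omits. The additional term is nonnegative and only enlarges the
      right side.\<close>
    have "load G x e j \<le> overlap G e j j + (\<Sum>k\<in>?N. usage G x e k * overlap G e j k)" if "e \<in> i" for e
      unfolding load_def
      using finite_players ji strategy_subset[OF ji] that usage_bounds(1)[OF asg] overlap_nonneg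
      by (intro add_left_mono sum_mono2) auto
    then have "(\<Sum>e\<in>i. load G x e j) \<le>
        (\<Sum>e\<in>i. overlap G e j j + (\<Sum>k\<in>?N. usage G x e k * overlap G e j k))"
      by (rule sum_mono)
    with nash_load[OF nash ji] have "(\<Sum>e\<in>?E. usage G x e j * load G x e j) \<le>
        (\<Sum>e\<in>i. overlap G e j j + (\<Sum>k\<in>?N. usage G x e k * overlap G e j k))"
      by (rule order_trans)
    then have "y j \<le> l * (\<Sum>e\<in>i. overlap G e j j) + l * (\<Sum>e\<in>i. \<Sum>k\<in>?N. usage G x e k * overlap G e j k)"
      unfolding y_def distrib_left[symmetric] sum.distrib[symmetric] using l by (intro mult_left_mono)
    then show "ereal (y j) \<le> (\<Sum>e\<in>i. ereal (weight G j) * ptime G e j)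
                       + ereal (- (1/2) * (v j i \<bullet> v j i) + v0 \<bullet> v j i)"
      unfolding own v0v[OF ji] vv[OF ji ji] by (simp add: l_def algebra_simps)
  next
    fix j i k i' assume ji: "j \<in> ?N" "i \<in> ?S j" and ki: "k \<in> ?N" "i' \<in> ?S k"
    \<comment> \<open>The inner product is \<open>b\<close> times this sum, and
      \<open>b \<le> 1\<close>; nonnegativity of the sum then gives the constraint.\<close>
    have "0 \<le> (\<Sum>e\<in>i \<inter> i'. overlap G e j k)"
      using strategy_subset[OF ji] ji ki overlap_nonneg by (intro sum_nonneg) auto
    then show "ereal (v j i \<bullet> v k i') \<le> (\<Sum>e\<in>i \<inter> i'. ereal (weight G j) * ereal (weight G k)
           * min (smith_ratio G e j) (smith_ratio G e k))"
      using b mult_right_mono[OF b(2)] by (simp only: vv[OF ji ki] pair_term[OF ji ki] ereal_less_eq mult_1_left)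
  qed (auto simp: v0_def v_def)
  moreover have "2 / (3 + sqrt 5) * C \<le> SDP_SR_objective G y v0"
  proof -
    have "l\<^sup>2 / b * (\<Sum>e\<in>?E. \<Sum>j\<in>?N. \<Sum>k\<in>?N. usage G x e j * usage G x e k * overlap G e j k) \<le> l\<^sup>2 / b * C"
      using square_le_social_cost[OF asg] b unfolding C_def by (intro mult_left_mono) auto
    moreover have "sum y ?N = l * C" by (simp add: y_def C_def sum_distrib_left)
    ultimately show ?thesis
      unfolding rate[symmetric] SDP_SR_objective_def v0v0 by (simp add: algebra_simps)
  qed
  ultimately show ?thesis unfolding PS_social_cost_eq C_def by (auto intro!: exI)
qed

section \<open>Weak duality with the Smith's Rule cost\<close>

text \<open>Under Smith's Rule two players sharing a resource cause one overlap, charged to the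
  later of them. The sum over ordered pairs counts it twice, hence the division by 2. In this
  symmetric form the cost can be compared with the squared norm of a sum of vectors.\<close>

lemma SR_social_cost_pure:
  assumes s: "\<And>j. j \<in> players G \<Longrightarrow> s j \<in> strategies G j"
    and x: "\<And>j i. j \<in> players G \<Longrightarrow> i \<in> strategies G j \<Longrightarrow> x j i = (if i = s j then 1 else 0)"
  shows "SR_social_cost G x = ereal ((\<Sum>j\<in>players G. \<Sum>e\<in>s j. overlap G e j j) +
    (\<Sum>j\<in>players G. \<Sum>k\<in>players G - {j}. \<Sum>e\<in>s j \<inter> s k. overlap G e j k) / 2)"
proof -
  let ?N = "players G" and ?E = "resources G"
  have u: "usage G x e k = (if e \<in> s k then 1 else 0)" if "k \<in> ?N" for e k
  proof -
    have "usage G x e k = (\<Sum>i | i \<in> strategies G k \<and> e \<in> i. if i = s k then 1 else 0)"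
      using that x by (auto simp: usage_def intro!: sum.cong)
    then show ?thesis using s[OF that] finite_strategies[OF that] by simp
  qed
  \<comment> \<open>Extending the overlap by 0 outside the shared resources lets all sums run over
    the whole resource set, so that they can be exchanged.\<close>
  define f where "f e j k = (if e \<in> s j \<and> e \<in> s k then overlap G e j k else 0)" for e j k
  have f_sym: "f e j k = f e k j" for e j k by (auto simp: f_def overlap_commute)
  define P where "P e j = (\<Sum>k | k \<in> ?N \<and> prec G e k j. f e j k)" for e j
  have summand: "ereal (weight G j) *
        (\<Sum>i\<in>strategies G j. ereal (x j i) *
           (\<Sum>e\<in>i. ptime G e j
              + (\<Sum>k | k \<in> players G \<and> prec G e k j. ptime G e k * ereal (usage G x e k))))
      = ereal (\<Sum>e\<in>s j. overlap G e j j + P e j)" if j: "j \<in> ?N" for j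
  proof -
    have "ptime G e j + (\<Sum>k | k \<in> players G \<and> prec G e k j. ptime G e k * ereal (usage G x e k))
        = ereal ((overlap G e j j + P e j) / weight G j)" if e: "e \<in> s j" for e
    proof -
      have "(\<Sum>k | k \<in> players G \<and> prec G e k j. ptime G e k * ereal (usage G x e k)) =
          (\<Sum>k | k \<in> players G \<and> prec G e k j. ereal (f e j k / weight G j))"
      proof (rule sum.cong[OF refl])
        fix k assume "k \<in> {k. k \<in> players G \<and> prec G e k j}"
        then show "ptime G e k * ereal (usage G x e k) = ereal (f e j k / weight G j)"
          using earlier_term[OF j s[OF j] e, of k x] u[of k e] e by (simp add: f_def)
      qed
      then show ?thesis
        by (simp add: own_term[OF j s[OF j] e] P_def add_divide_distrib sum_divide_distrib)
    qed
    then have "(\<Sum>e\<in>s j. ptime G e j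
         + (\<Sum>k | k \<in> players G \<and> prec G e k j. ptime G e k * ereal (usage G x e k)))
       = (\<Sum>e\<in>s j. ereal ((overlap G e j j + P e j) / weight G j))"
      by (intro sum.cong refl) auto
    also have "\<dots> = ereal ((\<Sum>e\<in>s j. overlap G e j j + P e j) / weight G j)"
      by (simp add: sum_divide_distrib)
    finally have chosen: "(\<Sum>e\<in>s j. ptime G e j
         + (\<Sum>k | k \<in> players G \<and> prec G e k j. ptime G e k * ereal (usage G x e k)))
       = ereal ((\<Sum>e\<in>s j. overlap G e j j + P e j) / weight G j)" .
    have "(\<Sum>i\<in>strategies G j. ereal (x j i) * F i) = F (s j)" for F :: "'e set \<Rightarrow> ereal"
    proof -
      have "(\<Sum>i\<in>strategies G j. ereal (x j i) * F i) = (\<Sum>i\<in>strategies G j. if i = s j then F i else 0)"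
        using x[OF j] by (intro sum.cong) (auto simp: zero_ereal_def[symmetric] one_ereal_def[symmetric])
      then show ?thesis using s[OF j] finite_strategies[OF j] by simp
    qed
    then show ?thesis using chosen weight_pos[OF j] by simp
  qed
  have restrict: "(\<Sum>e\<in>A. g e) = (\<Sum>e\<in>?E. if e \<in> A then g e else 0)" if "A \<subseteq> ?E"
    for A and g :: "'e \<Rightarrow> real"
    using that finite_resources by (simp add: sum.inter_restrict[symmetric] inf_absorb2)
  \<comment> \<open>The order only decides which of two equal terms is counted.\<close>
  have half: "2 * (\<Sum>j\<in>?N. P e j) = (\<Sum>j\<in>?N. \<Sum>k\<in>?N - {j}. f e j k)" if e: "e \<in> ?E" for e
  proof -
    have "(\<Sum>j\<in>?N. \<Sum>k\<in>?N - {j}. f e j k) =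
        (\<Sum>j\<in>?N. P e j + (\<Sum>k | k \<in> ?N \<and> prec G e j k. f e j k))"
      unfolding P_def
    proof (intro sum.cong refl)
      fix j assume j: "j \<in> ?N"
      show "(\<Sum>k\<in>?N - {j}. f e j k) = (\<Sum>k | k \<in> ?N \<and> prec G e k j. f e j k)
          + (\<Sum>k | k \<in> ?N \<and> prec G e j k. f e j k)"
        unfolding prec_split(1)[OF e j]
        using prec_split(2)[OF e j] finite_players by (intro sum.union_disjoint) auto
    qed
    \<comment> \<open>Exchanging the roles of \<open>j\<close> and \<open>k\<close> turns later
      terms into earlier ones, since \<open>f\<close> is symmetric.\<close>
    moreover have "(\<Sum>j\<in>?N. \<Sum>k | k \<in> ?N \<and> prec G e j k. f e j k) = (\<Sum>j\<in>?N. P e j)"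
      unfolding P_def
      by (subst sum.swap_restrict[OF finite_players finite_players]) (auto simp: f_sym intro!: sum.cong)
    ultimately show ?thesis by (simp add: sum.distrib)
  qed
  have "(\<Sum>j\<in>?N. \<Sum>e\<in>s j. P e j) = (\<Sum>j\<in>?N. \<Sum>e\<in>?E. P e j)"
  proof (rule sum.cong[OF refl])
    fix j assume j: "j \<in> ?N"
    show "(\<Sum>e\<in>s j. P e j) = (\<Sum>e\<in>?E. P e j)"
      by (subst restrict[OF strategy_subset[OF j s[OF j]]])
        (auto simp: P_def f_def intro!: sum.cong)
  qed
  then have "2 * (\<Sum>j\<in>?N. \<Sum>e\<in>s j. P e j) = (\<Sum>e\<in>?E. 2 * (\<Sum>j\<in>?N. P e j))"
    by (subst (asm) sum.swap) (simp add: sum_distrib_left)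
  also have "\<dots> = (\<Sum>e\<in>?E. \<Sum>j\<in>?N. \<Sum>k\<in>?N - {j}. f e j k)"
    using half by simp
  also have "\<dots> = (\<Sum>j\<in>?N. \<Sum>e\<in>?E. \<Sum>k\<in>?N - {j}. f e j k)" by (rule sum.swap)
  also have "\<dots> = (\<Sum>j\<in>?N. \<Sum>k\<in>?N - {j}. \<Sum>e\<in>?E. f e j k)"
    by (intro sum.cong refl sum.swap)
  also have "\<dots> = (\<Sum>j\<in>?N. \<Sum>k\<in>?N - {j}. \<Sum>e\<in>s j \<inter> s k. overlap G e j k)"
  proof (rule sum.cong[OF refl], rule sum.cong[OF refl])
    fix j k assume j: "j \<in> ?N"
    have "s j \<inter> s k \<subseteq> ?E" using strategy_subset[OF j s[OF j]] by blast
    then show "(\<Sum>e\<in>?E. f e j k) = (\<Sum>e\<in>s j \<inter> s k. overlap G e j k)"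
      by (subst restrict) (auto simp: f_def intro!: sum.cong)
  qed
  finally have "(\<Sum>j\<in>?N. \<Sum>e\<in>s j. P e j) =
    (\<Sum>j\<in>?N. \<Sum>k\<in>?N - {j}. \<Sum>e\<in>s j \<inter> s k. overlap G e j k) / 2" by simp
  moreover have "SR_social_cost G x = ereal (\<Sum>j\<in>?N. \<Sum>e\<in>s j. overlap G e j j + P e j)"
    unfolding SR_social_cost_def by (subst sum_ereal[symmetric]) (auto simp: summand intro!: sum.cong)
  ultimately show ?thesis by (simp add: sum.distrib)
qed

lemma pure_assignmentE:
  assumes "pure_assignment G x"
  obtains s where "\<And>j. j \<in> players G \<Longrightarrow> s j \<in> strategies G j"
    and "\<And>j i. j \<in> players G \<Longrightarrow> i \<in> strategies G j \<Longrightarrow> x j i = (if i = s j then 1 else 0)"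
proof -
  have "\<exists>s. s \<in> strategies G j \<and> (\<forall>i\<in>strategies G j. x j i = (if i = s then 1 else 0))"
    if j: "j \<in> players G" for j
  proof -
    have x: "\<forall>i\<in>strategies G j. x j i = 0 \<or> x j i = 1" "(\<Sum>i\<in>strategies G j. x j i) = 1"
      using assms j by (auto simp: pure_assignment_def assignment_def)
    then obtain s where s: "s \<in> strategies G j" "x j s = 1"
      by (metis sum.neutral zero_neq_one)
    have "(\<Sum>i\<in>strategies G j - {s}. x j i) = 0"
      using x s sum.remove[OF finite_strategies[OF j] s(1), of "x j"] by simp
    moreover have "\<forall>i\<in>strategies G j - {s}. 0 \<le> x j i" using x(1) by force
    ultimately have "\<forall>i\<in>strategies G j - {s}. x j i = 0"
      using finite_strategies[OF j] by (subst (asm) sum_nonneg_eq_0_iff) auto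
    then show ?thesis using s by auto
  qed
  then show ?thesis using that by metis
qed

text \<open>Let \<open>V\<close> be the sum of the chosen vectors \<open>u j\<close>. The terms with
  \<open>v0\<close> contribute at most half the squared norm of \<open>V\<close>. Its diagonal part
  cancels the negative squared norms in the first constraints, and its off-diagonal part is bounded
  by the second constraints; what remains is the Smith's Rule cost.\<close>

lemma weak_duality:
  assumes feas: "SDP_SR_feasible G D y v0 v" and "pure_assignment G x"
  shows "ereal (SDP_SR_objective G y v0) \<le> SR_social_cost G x"
proof -
  let ?N = "players G"
  obtain s where s: "\<And>j. j \<in> ?N \<Longrightarrow> s j \<in> strategies G j"
    and x: "\<And>j i. j \<in> ?N \<Longrightarrow> i \<in> strategies G j \<Longrightarrow> x j i = (if i = s j then 1 else 0)"
    using pure_assignmentE[OF assms(2)] by blast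
  define u where "u j = v j (s j)" for j
  have dim: "dim_vec v0 = D" "\<And>j. j \<in> ?N \<Longrightarrow> dim_vec (u j) = D"
    using feas s by (auto simp: SDP_SR_feasible_def u_def)
  have y: "y j \<le> (\<Sum>e\<in>s j. overlap G e j j) - (u j \<bullet> u j) / 2 + v0 \<bullet> u j" if j: "j \<in> ?N" for j
  proof -
    have own: "(\<Sum>e\<in>s j. ereal (weight G j) * ptime G e j) = ereal (\<Sum>e\<in>s j. overlap G e j j)"
      using own_term[OF j s[OF j]] weight_pos[OF j] by (subst sum_ereal[symmetric]) (auto intro!: sum.cong)
    have "ereal (y j) \<le> (\<Sum>e\<in>s j. ereal (weight G j) * ptime G e j)
                       + ereal (- (1/2) * (u j \<bullet> u j) + v0 \<bullet> u j)"
      using feas j s[OF j] unfolding SDP_SR_feasible_def u_def by blast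
    then show ?thesis unfolding own by simp
  qed
  have uu: "u j \<bullet> u k \<le> (\<Sum>e\<in>s j \<inter> s k. overlap G e j k)" if j: "j \<in> ?N" and k: "k \<in> ?N - {j}" for j k
  proof -
    \<comment> \<open>The pairs differ in the player even if both players choose the same set of
      resources.\<close>
    have k: "k \<in> ?N" "(s j, j) \<noteq> (s k, k)" using k by auto
    have "ereal (u j \<bullet> u k) \<le> (\<Sum>e\<in>s j \<inter> s k. ereal (weight G j) * ereal (weight G k)
           * min (smith_ratio G e j) (smith_ratio G e k))"
      unfolding u_def
      by (rule feas[unfolded SDP_SR_feasible_def, THEN conjunct2, THEN conjunct2, THEN conjunct2,
            rule_format, OF j s[OF j] k(1) s[OF k(1)] k(2)])
    then show ?thesis
      by (simp only: pair_term[OF j s[OF j] k(1) s[OF k(1)]] ereal_less_eq)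
  qed
  have "(\<Sum>j\<in>?N. v0 \<bullet> u j) - (v0 \<bullet> v0) / 2 \<le> (\<Sum>j\<in>?N. \<Sum>k\<in>?N. u j \<bullet> u k) / 2"
  proof -
    have "(\<Sum>j\<in>?N. \<Sum>k\<in>?N. u j \<bullet> u k) = (\<Sum>n = 0..<D. (\<Sum>j\<in>?N. u j $ n) * (\<Sum>k\<in>?N. u k $ n))"
      unfolding inner_sum_sum scalar_prod_def by (auto simp: dim intro!: sum.cong)
    moreover have "(\<Sum>j\<in>?N. v0 \<bullet> u j) = (\<Sum>j\<in>?N. \<Sum>n = 0..<D. v0 $ n * u j $ n)"
      unfolding scalar_prod_def by (auto simp: dim intro!: sum.cong)
    then have "(\<Sum>j\<in>?N. v0 \<bullet> u j) = (\<Sum>n = 0..<D. v0 $ n * (\<Sum>j\<in>?N. u j $ n))"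
      by (subst (asm) sum.swap) (simp add: sum_distrib_left)
    moreover have "v0 \<bullet> v0 = (\<Sum>n = 0..<D. v0 $ n * v0 $ n)"
      by (simp add: scalar_prod_def dim)
    moreover have "(\<Sum>n = 0..<D. v0 $ n * (\<Sum>j\<in>?N. u j $ n)) - (\<Sum>n = 0..<D. v0 $ n * v0 $ n) / 2
        \<le> (\<Sum>n = 0..<D. (\<Sum>j\<in>?N. u j $ n) * (\<Sum>k\<in>?N. u k $ n)) / 2"
    proof -
      have "a * c - a * a / 2 \<le> c * c / 2" for a c :: real
        using zero_le_square[of "a - c"] by (simp add: algebra_simps)
      then show ?thesis
        unfolding sum_divide_distrib sum_subtractf[symmetric] by (intro sum_mono)
    qed
    ultimately show ?thesis by simp
  qed
  moreover have "(\<Sum>j\<in>?N. \<Sum>k\<in>?N. u j \<bullet> u k) \<le>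
      (\<Sum>j\<in>?N. u j \<bullet> u j) + (\<Sum>j\<in>?N. \<Sum>k\<in>?N - {j}. \<Sum>e\<in>s j \<inter> s k. overlap G e j k)"
    unfolding sum.distrib[symmetric]
    by (intro sum_mono) (simp add: sum.remove[OF finite_players], intro sum_mono uu)
  moreover have "sum y ?N \<le>
      (\<Sum>j\<in>?N. \<Sum>e\<in>s j. overlap G e j j) - (\<Sum>j\<in>?N. u j \<bullet> u j) / 2 + (\<Sum>j\<in>?N. v0 \<bullet> u j)"
    unfolding sum_divide_distrib sum_subtractf[symmetric] sum.distrib[symmetric]
    using y by (intro sum_mono)
  moreover have "SR_social_cost G x = ereal ((\<Sum>j\<in>?N. \<Sum>e\<in>s j. overlap G e j j) +
      (\<Sum>j\<in>?N. \<Sum>k\<in>?N - {j}. \<Sum>e\<in>s j \<inter> s k. overlap G e j k) / 2)"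
    using s x by (rule SR_social_cost_pure)
  ultimately show ?thesis
    unfolding SDP_SR_objective_def by simp
qed

section \<open>The coordination ratio\<close>

lemma PS_le_SR:
  assumes "PS_nash G x" "pure_assignment G xs"
  shows "PS_social_cost G x \<le> ereal ((3 + sqrt 5) / 2) * SR_social_cost G xs"
proof -
  have "ereal (2 / (3 + sqrt 5)) * PS_social_cost G x \<le> SR_social_cost G xs"
    using SDP_solution[OF assms(1)] weak_duality[OF _ assms(2)] by (metis order_trans)
  then have "ereal ((3 + sqrt 5) / 2) * (ereal (2 / (3 + sqrt 5)) * PS_social_cost G x)
      \<le> ereal ((3 + sqrt 5) / 2) * SR_social_cost G xs"
    by (intro ereal_mult_left_mono) auto
  moreover have "(3 + sqrt 5) / 2 * (2 / (3 + sqrt 5)) = 1"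
    by (simp add: add_pos_pos less_imp_neq[THEN not_sym])
  ultimately show ?thesis
    by (simp only: mult.assoc[symmetric] times_ereal.simps one_ereal_def[symmetric] mult_1_left)
qed

lemma PS_social_cost_nonneg:
  assumes "assignment G x"
  shows "0 \<le> PS_social_cost G x"
  unfolding PS_social_cost_eq load_def
  using usage_bounds(1)[OF assms] overlap_nonneg
  by (auto intro!: sum_nonneg mult_nonneg_nonneg add_nonneg_nonneg)

lemma coordination_ratio_le: "PS_coordination_ratio G \<le> ereal ((3 + sqrt 5) / 2)"
  unfolding PS_coordination_ratio_def
proof (rule SUP_least)
  fix x assume "x \<in> {x. PS_nash G x}"
  then have x: "PS_nash G x" by simp
  define K where "K = (3 + sqrt 5) / 2"
  define I where "I = (INF x'\<in>{x'. pure_assignment G x'}. SR_social_cost G x')"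
  define C where "C = PS_social_cost G x"
  have K: "0 < K" by (simp add: K_def add_pos_pos)
  have C0: "0 \<le> C" using PS_social_cost_nonneg x by (auto simp: C_def PS_nash_def)
  \<comment> \<open>Dividing by \<open>K\<close> makes the left side a lower bound for every Smith's
    Rule cost, hence for their infimum.\<close>
  have "C / ereal K \<le> SR_social_cost G x'" if "pure_assignment G x'" for x'
    using PS_le_SR[OF x that] K by (simp add: C_def K_def[symmetric] ereal_divide_le_pos)
  then have "C / ereal K \<le> I"
    unfolding I_def by (intro INF_greatest) simp
  moreover obtain c where c: "C = ereal c" by (simp add: C_def PS_social_cost_eq)
  ultimately have le: "ereal (c / K) \<le> I" using K by simp
  have c0: "0 \<le> c" using C0 c by simp
  have "C / I \<le> ereal K"
  \<comment> \<open>If \<open>I\<close> is 0, then \<open>c\<close> is 0 as well and the quotient is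
    0 by convention. An infinite \<open>I\<close> also gives quotient 0, and \<open>le\<close>
    excludes minus infinity.\<close>
  proof (cases I)
    case (real r)
    then have "c \<le> K * r" using le K by (simp add: field_simps)
    moreover have "0 \<le> r" using real le c0 K order_trans[of 0 "c / K" r] by simp
    ultimately show ?thesis
      using real c c0 K by (cases "r = 0") (auto simp: field_simps)
  qed (use le c K in auto)
  then show "PS_social_cost G x / (INF x'\<in>{x'. pure_assignment G x'}. SR_social_cost G x')
      \<le> ereal ((3 + sqrt 5) / 2)"
    by (simp add: C_def I_def K_def)
qed

end

theorem theorem4p4:
  fixes G :: "('n, 'e) congestion_instance"
  assumes "congestion_game G"
  shows
    "(\<forall>x. PS_nash G x \<longrightarrow>
        (\<exists>d y v0 v. SDP_SR_feasible G d y v0 v \<and>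
           ereal (SDP_SR_objective G y v0) \<ge> ereal (2 / (3 + sqrt 5)) * PS_social_cost G x)) \<and>
     PS_coordination_ratio G \<le> ereal ((3 + sqrt 5) / 2) \<and>
     (\<forall>x xs. PS_nash G x \<longrightarrow> pure_assignment G xs \<longrightarrow>
        PS_social_cost G x \<le> ereal ((3 + sqrt 5) / 2) * SR_social_cost G xs)"
proof -
  interpret congestion G using assms by unfold_locales
  show ?thesis using SDP_solution coordination_ratio_le PS_le_SR by blast
qed

end
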